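(* Let $\delta\ne0$. (a) If $(V_t)_{t\in\mathbb R}$ is stochastically continuous and $\delta$-translatively stable with $V_t\to0$ in probability as $t\downarrow-\infty$, then $(Z_t:=V_{\log t})_{t\ge0}$ (with $V_{-\infty}:=0$) is $\delta$-time stable. Conversely, if $(Z_t)_{t\ge0}$ is a $\delta$-time stable process, then $(V_t:=Z_{e^t})_{t\in\mathbb R}$ is $\delta$-translatively stable. (b) If $(V_t)_{t\in\mathbb R}$ is $\delta$-translatively stable, then $(D_t:=V_{\frac1\delta\log t})_{t\ge0}$ (with $V_{-\infty}:=0=:V_{\infty}$, so $D_0=0$) is IDT. Conversely, if $(D_t)_{t\ge0}$ is IDT and all its finite-dimensional distributions are weakly right-continuous, then $(V_t:=D_{e^{\delta t}})_{t\in\mathbb R}$ is $\delta$-translatively stable.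
   Context: All processes are real-valued. A process is infinitely divisible if all its finite-dimensional distributions are. For an infinitely divisible process $X$, $\Psi^X_{t_1,\dots,t_k}:\mathbb R^k\to\mathbb C$ denotes the log-characteristic function (Lévy exponent) of $(X_{t_1},\dots,X_{t_k})$, i.e. the unique continuous function with $\Psi^X_{t_1,\dots,t_k}(0,\dots,0)=0$ and $\mathbb E[\exp(i\sum_j\theta_jX_{t_j})]=\exp(\Psi^X_{t_1,\dots,t_k}(\theta_1,\dots,\theta_k))$. An infinitely divisible process $(V_t)_{t\in\mathbb R}$ is $\delta$-translatively stable if $\Psi^V_{t_1+T,\dots,t_k+T}(\theta_1,\dots,\theta_k)=e^{\delta T}\Psi^V_{t_1,\dots,t_k}(\theta_1,\dots,\theta_k)$ for all $T\in\mathbb R$, $k\in\mathbb N$, $t_1,\dots,t_k,\theta_1,\dots,\theta_k\in\mathbb R$. An (infinitely divisible) process $(D_t)_{t\ge0}$ is infinitely divisible with respect to time (IDT) if for every $n\in\mathbb N$, $\Psi^D_{nt_1,\dots,nt_k}(\theta_1,\dots,\theta_k)=n\,\Psi^D_{t_1,\dots,t_k}(\theta_1,\dots,\theta_k)$ for all $k\in\mathbb N$, $t_1,\dots,t_k\ge0$, $\theta_1,\dots,\theta_k\in\mathbb R$. A stochastically continuous (infinitely divisible) process $(Z_t)_{t\ge0}$ is $\delta$-time stable ($\delta\ne0$) if for every $n\in\mathbb N$, $\Psi^Z_{n^{1/\delta}t_1,\dots,n^{1/\delta}t_k}(\theta_1,\dots,\theta_k)=n\,\Psi^Z_{t_1,\dots,t_k}(\theta_1,\dots,\theta_k)$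 for all $k\in\mathbb N$, $t_1,\dots,t_k\ge0$, $\theta_1,\dots,\theta_k\in\mathbb R$. Finite-dimensional distributions of $D$ are weakly right-continuous if $(D_{s_1},\dots,D_{s_k})\to(D_{t_1},\dots,D_{t_k})$ in distribution as $s_i\downarrow t_i$ for $i=1,\dots,k$. *)

theory Defs
  imports "HOL-Probability.Probability"
begin

text \<open>
  \<open>\<real>\<^sup>k\<close> is the function space \<open>{..<k} \<rightarrow>\<^sub>E UNIV\<close> with the product topology and the product
  sigma-algebra, so that \<open>k\<close> can be quantified over. A tuple of times is a function on \<open>nat\<close> of
  which only the first \<open>k\<close> values matter.
\<close>

abbreviation Rvec :: "nat \<Rightarrow> (nat \<Rightarrow> real) set" where
  "Rvec k \<equiv> {..<k} \<rightarrow>\<^sub>E UNIV"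

abbreviation Rvec_top :: "nat \<Rightarrow> (nat \<Rightarrow> real) topology" where
  "Rvec_top k \<equiv> product_topology (\<lambda>_. euclideanreal) {..<k}"

abbreviation Rvec_borel :: "nat \<Rightarrow> (nat \<Rightarrow> real) measure" where
  "Rvec_borel k \<equiv> PiM {..<k} (\<lambda>_. borel)"

definition real_process :: "'a measure \<Rightarrow> real set \<Rightarrow> (real \<Rightarrow> 'a \<Rightarrow> real) \<Rightarrow> bool" where
  "real_process M T X \<longleftrightarrow> prob_space M \<and> (\<forall>t\<in>T. X t \<in> borel_measurable M)"

definition fdd :: "'a measure \<Rightarrow> (real \<Rightarrow> 'a \<Rightarrow> real) \<Rightarrow> nat \<Rightarrow> (nat \<Rightarrow> real) \<Rightarrow> (nat \<Rightarrow> real) measure" where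
  "fdd M X k t = distr M (Rvec_borel k) (\<lambda>\<omega>. \<lambda>j\<in>{..<k}. X (t j) \<omega>)"

text \<open>A law on \<open>\<real>\<^sup>k\<close> is infinitely divisible if, for every \<open>n \<ge> 1\<close>, it is the law of a sum of \<open>n\<close>
  i.i.d. random vectors.\<close>

definition infinitely_divisible_law :: "nat \<Rightarrow> (nat \<Rightarrow> real) measure \<Rightarrow> bool" where
  "infinitely_divisible_law k \<mu> \<longleftrightarrow>
     (\<forall>n::nat. n \<ge> 1 \<longrightarrow> (\<exists>\<nu>. prob_space \<nu> \<and> sets \<nu> = sets (Rvec_borel k) \<and>
        \<mu> = distr (PiM {..<n} (\<lambda>_. \<nu>)) (Rvec_borel k) (\<lambda>w. \<lambda>j\<in>{..<k}. \<Sum>m<n. w m j)))"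

definition infinitely_divisible :: "'a measure \<Rightarrow> real set \<Rightarrow> (real \<Rightarrow> 'a \<Rightarrow> real) \<Rightarrow> bool" where
  "infinitely_divisible M T X \<longleftrightarrow>
     real_process M T X \<and> (\<forall>k. \<forall>t\<in>{..<k} \<rightarrow> T. infinitely_divisible_law k (fdd M X k t))"

text \<open>The log-characteristic function of \<open>(X (t 0), \<dots>, X (t (k - 1)))\<close>. The clause
  \<open>\<psi> \<in> extensional (Rvec k)\<close> only fixes the values of \<open>\<psi>\<close> outside \<open>\<real>\<^sup>k\<close>, without which \<open>\<psi>\<close> would not
  be unique as a total function.\<close>

definition log_char ::
  "'a measure \<Rightarrow> (real \<Rightarrow> 'a \<Rightarrow> real) \<Rightarrow> nat \<Rightarrow> (nat \<Rightarrow> real) \<Rightarrow> (nat \<Rightarrow> real) \<Rightarrow> complex" where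
  "log_char M X k t = (THE \<psi>.
     \<psi> \<in> extensional (Rvec k) \<and>
     continuous_map (Rvec_top k) euclidean \<psi> \<and>
     \<psi> (\<lambda>j\<in>{..<k}. 0) = 0 \<and>
     (\<forall>\<theta>\<in>Rvec k. (LINT \<omega>|M. iexp (\<Sum>j<k. \<theta> j * X (t j) \<omega>)) = exp (\<psi> \<theta>)))"

definition translatively_stable :: "real \<Rightarrow> 'a measure \<Rightarrow> (real \<Rightarrow> 'a \<Rightarrow> real) \<Rightarrow> bool" where
  "translatively_stable \<delta> M V \<longleftrightarrow>
     infinitely_divisible M UNIV V \<and>
     (\<forall>T k. \<forall>t\<in>{..<k} \<rightarrow> UNIV. \<forall>\<theta>\<in>Rvec k.
        log_char M V k (\<lambda>j. t j + T) \<theta> = of_real (exp (\<delta> * T)) * log_char M V k t \<theta>)"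

definition IDT :: "'a measure \<Rightarrow> (real \<Rightarrow> 'a \<Rightarrow> real) \<Rightarrow> bool" where
  "IDT M D \<longleftrightarrow>
     infinitely_divisible M {0..} D \<and>
     (\<forall>n::nat. n \<ge> 1 \<longrightarrow> (\<forall>k. \<forall>t\<in>{..<k} \<rightarrow> {0..}. \<forall>\<theta>\<in>Rvec k.
        log_char M D k (\<lambda>j. real n * t j) \<theta> = of_nat n * log_char M D k t \<theta>))"

definition tends_in_prob ::
  "'a measure \<Rightarrow> (real \<Rightarrow> 'a \<Rightarrow> real) \<Rightarrow> ('a \<Rightarrow> real) \<Rightarrow> real filter \<Rightarrow> bool" where
  "tends_in_prob M X Y F \<longleftrightarrow>
     (\<forall>\<epsilon>>0. ((\<lambda>s. measure M {\<omega>\<in>space M. \<bar>X s \<omega> - Y \<omega>\<bar> > \<epsilon>}) \<longlongrightarrow> 0) F)"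

definition stochastically_continuous :: "'a measure \<Rightarrow> real set \<Rightarrow> (real \<Rightarrow> 'a \<Rightarrow> real) \<Rightarrow> bool" where
  "stochastically_continuous M T X \<longleftrightarrow> (\<forall>t\<in>T. tends_in_prob M X (X t) (at t within T))"

definition time_stable :: "real \<Rightarrow> 'a measure \<Rightarrow> (real \<Rightarrow> 'a \<Rightarrow> real) \<Rightarrow> bool" where
  "time_stable \<delta> M Z \<longleftrightarrow>
     infinitely_divisible M {0..} Z \<and> stochastically_continuous M {0..} Z \<and>
     (\<forall>n::nat. n \<ge> 1 \<longrightarrow> (\<forall>k. \<forall>t\<in>{..<k} \<rightarrow> {0..}. \<forall>\<theta>\<in>Rvec k.
        log_char M Z k (\<lambda>j. real n powr (1 / \<delta>) * t j) \<theta> = of_nat n * log_char M Z k t \<theta>))"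

definition vec_weakly_converges ::
  "nat \<Rightarrow> (nat \<Rightarrow> (nat \<Rightarrow> real) measure) \<Rightarrow> (nat \<Rightarrow> real) measure \<Rightarrow> bool" where
  "vec_weakly_converges k \<mu>s \<mu> \<longleftrightarrow>
     (\<forall>f. continuous_map (Rvec_top k) euclideanreal f \<and> bounded (f ` Rvec k) \<longrightarrow>
        (\<lambda>m. LINT x|\<mu>s m. f x) \<longlonglongrightarrow> (LINT x|\<mu>. f x))"

text \<open>Right limits are taken along \<open>s\<^sub>i > t\<^sub>i\<close>. Required at all tuples of times, this is equivalent to
  allowing \<open>s\<^sub>i \<ge> t\<^sub>i\<close>.\<close>

definition fdd_weakly_right_continuous ::
  "'a measure \<Rightarrow> real set \<Rightarrow> (real \<Rightarrow> 'a \<Rightarrow> real) \<Rightarrow> bool" where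
  "fdd_weakly_right_continuous M T X \<longleftrightarrow>
     (\<forall>k. \<forall>t\<in>{..<k} \<rightarrow> T. \<forall>s :: nat \<Rightarrow> nat \<Rightarrow> real.
        (\<forall>i<k. (\<forall>m. s m i \<in> T) \<and> filterlim (\<lambda>m. s m i) (at_right (t i)) sequentially) \<longrightarrow>
        vec_weakly_converges k (\<lambda>m. fdd M X k (s m)) (fdd M X k t))"

end

theory Submission
  imports Defs
begin

text \<open>
  Infinite divisibility makes every finite-dimensional characteristic function nonvanishing, so it has
  a continuous logarithm; this logarithm is unique, since two of them differ along each ray by a
  continuous function with values in \<open>2 \<pi> \<i> \<int>\<close>. All four claims compare logarithms of the same
  characteristic functions. From stability under \<open>T \<in> \<real>\<close> to integer scalings, substitute \<open>t = ln s\<close>;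
  times \<open>s = 0\<close> just delete coordinates, i.e. set the corresponding \<open>\<theta>\<^sub>j\<close> to 0. In the converse
  direction integer scalings give rational scalings \<open>\<psi>\<^bsub>q t\<^esub> = q \<psi>\<^bsub>t\<^esub>\<close>, and for \<open>q \<down> c\<close> either continuity
  assumption gives pointwise convergence of the characteristic functions, so that the one at \<open>c t\<close>
  is \<open>exp (c \<psi>\<^bsub>t\<^esub>)\<close>; uniqueness of the logarithm concludes.
\<close>

section \<open>Nonvanishing of infinitely divisible characteristic functions\<close>

lemma (in real_distribution) Re_cis_char:
  "Re (cis (- a) * char M s) = (LINT x|M. cos (s * x - a))"
proof -
  have int: "integrable M (\<lambda>x. iexp (s * x))"
    by (rule integrable_iexp) auto
  have "Re (cis (- a) * char M s) = Re (CLINT x|M. cis (- a) * iexp (s * x))"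
    unfolding char_def by (subst integral_mult_right_zero) simp
  also have "\<dots> = (LINT x|M. Re (cis (- a) * iexp (s * x)))"
    using int by (subst integral_Re) auto
  also have "\<dots> = (LINT x|M. cos (s * x - a))"
    by (intro Bochner_Integration.integral_cong refl) (simp add: Re_exp Im_exp cos_diff)
  finally show ?thesis .
qed

text \<open>Rotating \<open>char M s\<close> to the positive real axis turns \<open>1 - cos 2x \<le> 4 (1 - cos x)\<close> into an
  inequality between moduli, so no symmetrization is needed.\<close>

lemma (in real_distribution) cmod_char_double:
  "1 - cmod (char M (2 * s)) \<le> 4 * (1 - cmod (char M s))"
proof -
  define a where "a = Arg (char M s)"
  have "char M s = cmod (char M s) * cis a"
    unfolding a_def by (cases "char M s = 0") (auto simp: cis_Arg sgn_eq)
  then have "cis (- a) * char M s = cmod (char M s)"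
    by (metis (no_types, opaque_lifting) cis_inverse cis_neq_zero left_inverse mult.commute
        mult.left_commute mult.right_neutral)
  then have r: "cmod (char M s) = (LINT x|M. cos (s * x - a))"
    using Re_cis_char[of a s] by simp
  have [simp]: "integrable M (\<lambda>x. cos (u * x - b))" for u b
    by (rule integrable_const_bound[of _ 1]) auto
  \<comment> \<open>Rotating by \<open>2 * a\<close> keeps the argument of the cosine equal to twice
    \<open>s * x - a\<close>; after any rotation the real part is a lower bound for the
    modulus.\<close>
  have "1 - cmod (char M (2 * s)) \<le> 1 - Re (cis (- (2 * a)) * char M (2 * s))"
    using complex_Re_le_cmod[of "cis (- (2 * a)) * char M (2 * s)"] by (simp add: norm_mult)
  also have "\<dots> = (LINT x|M. 1 - cos (2 * s * x - 2 * a))"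
    by (subst Re_cis_char) (simp add: prob_space del: space_eq_univ)
  also have "\<dots> \<le> (LINT x|M. 4 * (1 - cos (s * x - a)))"
  proof (rule integral_mono)
    fix x
    have "cos (2 * s * x - 2 * a) = 2 * (cos (s * x - a))\<^sup>2 - 1"
      using cos_double_cos[of "s * x - a"] by (simp add: algebra_simps)
    \<comment> \<open>With y = s x - a, the right side of the goal exceeds the left by exactly 2
      (cos y - 1)^2.\<close>
    moreover have "(cos (s * x - a) - 1)\<^sup>2 \<ge> 0"
      by simp
    ultimately show "1 - cos (2 * s * x - 2 * a) \<le> 4 * (1 - cos (s * x - a))"
      by (simp add: power2_eq_square algebra_simps)
  qed auto
  also have "\<dots> = 4 * (1 - cmod (char M s))"
    unfolding r by (simp add: prob_space del: space_eq_univ)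
  finally show ?thesis .
qed

text \<open>A zero at s forces one at s / 2: the n-th root also vanishes at s, yet its modulus at s
  / 2 would be the n-th root of a positive number, which tends to 1, against
  \<open>cmod_char_double\<close>. Repeated halving gives zeros tending to 0, where the
  characteristic function is continuous with value 1.\<close>

lemma char_nonzero_if_roots:
  assumes \<rho>: "real_distribution \<rho>"
    and roots: "\<And>n. n \<ge> 1 \<Longrightarrow> \<exists>\<nu>. real_distribution \<nu> \<and> (\<forall>s. char \<rho> s = char \<nu> s ^ n)"
  shows "char \<rho> s \<noteq> 0"
proof
  assume 0: "char \<rho> s = 0"
  have half: "char \<rho> (s / 2) = 0" if "char \<rho> s = 0" for s
  proof (rule ccontr)
    define r where "r = cmod (char \<rho> (s / 2))"
    assume "char \<rho> (s / 2) \<noteq> 0"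
    then have "r > 0"
      by (simp add: r_def)
    then have "(\<lambda>n. root n r) \<longlonglongrightarrow> 1"
      by (rule LIMSEQ_root_const)
    \<comment> \<open>For a root vanishing at \<open>s\<close>, \<open>cmod_char_double\<close> at
      \<open>s / 2\<close> reads 1 <= 4 (1 - modulus), which caps the modulus at 3/4.\<close>
    then have "\<forall>\<^sub>F n in sequentially. root n r > 3 / 4"
      by (rule order_tendstoD) simp
    then obtain n where n: "n \<ge> 1" "root n r > 3 / 4"
      by (metis eventually_at_top_linorder max.cobounded1 max.cobounded2)
    then obtain \<nu> where \<nu>: "real_distribution \<nu>" "\<And>s. char \<rho> s = char \<nu> s ^ n"
      using roots by blast
    interpret \<nu>: real_distribution \<nu> by fact
    have "cmod (char \<nu> (s / 2)) = root n r"
      using n by (simp add: r_def \<nu>(2) norm_power real_root_power_cancel)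
    moreover have "char \<nu> s = 0"
      using that n \<nu>(2)[of s] by simp
    ultimately show False
      using \<nu>.cmod_char_double[of "s / 2"] n by simp
  qed
  interpret \<rho>: real_distribution \<rho> by fact
  have "char \<rho> (s / 2 ^ m) = 0" for m
  proof (induction m)
    case (Suc m)
    then show ?case
      using half[of "s / 2 ^ m"] by (simp add: mult.commute)
  qed (simp add: 0)
  moreover have "(\<lambda>m. char \<rho> (s / 2 ^ m)) \<longlonglongrightarrow> char \<rho> 0"
    by (rule isCont_tendsto_compose[OF \<rho>.isCont_char])
       (rule LIMSEQ_divide_realpow_zero, simp)
  ultimately show False
    by (simp add: \<rho>.char_zero LIMSEQ_const_iff)
qed

section \<open>Continuous logarithms on \<open>\<real>\<^sup>k\<close>\<close>

abbreviation joint_char ::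
  "'a measure \<Rightarrow> (real \<Rightarrow> 'a \<Rightarrow> real) \<Rightarrow> nat \<Rightarrow> (nat \<Rightarrow> real) \<Rightarrow> (nat \<Rightarrow> real) \<Rightarrow> complex" where
  "joint_char M X k t \<theta> \<equiv> (LINT \<omega>|M. iexp (\<Sum>j<k. \<theta> j * X (t j) \<omega>))"

text \<open>The condition under \<open>THE\<close> in \<open>log_char\<close>, named so that
  existence and uniqueness can be proved separately.\<close>

definition is_log_char ::
  "'a measure \<Rightarrow> (real \<Rightarrow> 'a \<Rightarrow> real) \<Rightarrow> nat \<Rightarrow> (nat \<Rightarrow> real) \<Rightarrow> ((nat \<Rightarrow> real) \<Rightarrow> complex) \<Rightarrow> bool" where
  "is_log_char M X k t \<psi> \<longleftrightarrow>
     \<psi> \<in> extensional (Rvec k) \<and>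
     continuous_map (Rvec_top k) euclidean \<psi> \<and>
     \<psi> (\<lambda>j\<in>{..<k}. 0) = 0 \<and>
     (\<forall>\<theta>\<in>Rvec k. joint_char M X k t \<theta> = exp (\<psi> \<theta>))"

text \<open>The ray joins each point to the origin, where both logarithms vanish, and turns
  continuity in the product topology into continuity on the line.\<close>

lemma is_log_char_unique:
  assumes "is_log_char M X k t \<psi>" "is_log_char M X k t \<psi>'"
  shows "\<psi> = \<psi>'"
proof (rule extensionalityI)
  show "\<psi> \<in> extensional (Rvec k)" "\<psi>' \<in> extensional (Rvec k)"
    using assms by (auto simp: is_log_char_def)
  fix \<theta> assume \<theta>: "\<theta> \<in> Rvec k"
  define ray where "ray = (\<lambda>s. \<lambda>j\<in>{..<k}. s * \<theta> j)"
  define g where "g s = \<psi> (ray s) - \<psi>' (ray s)" for s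
  have ray: "ray s \<in> Rvec k" for s
    by (auto simp: ray_def)
  have "continuous_map euclideanreal (Rvec_top k) ray"
    unfolding ray_def continuous_map_componentwise
    by (auto intro!: continuous_intros simp: continuous_map_iff_continuous2)
  then have "continuous_map euclideanreal euclidean (\<psi> \<circ> ray)"
    "continuous_map euclideanreal euclidean (\<psi>' \<circ> ray)"
    using assms unfolding is_log_char_def by (blast intro: continuous_map_compose)+
  then have cont: "continuous_on UNIV g"
    unfolding g_def by (intro continuous_on_diff) (simp_all add: o_def continuous_map_iff_continuous2)
  have exp_g: "exp (g s) = 1" for s
    using assms ray[of s] unfolding is_log_char_def g_def exp_diff by force
  have "g constant_on UNIV"
  proof (rule continuous_discrete_range_constant[OF _ cont])
    fix x
    \<comment> \<open>Distinct values of \<open>g\<close> differ by a nonzero multiple of 2 pi i,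
      hence by at least 2 pi; a continuous function on the line with such a range is
      constant.\<close>
    have "2 * pi \<le> norm (g y - g x)" if "g y \<noteq> g x" for y
    proof -
      have "exp (g y - g x) = 1"
        by (simp add: exp_diff exp_g)
      then obtain n :: int where n: "Re (g y - g x) = 0" "Im (g y - g x) = of_int (2 * n) * pi"
        using exp_eq_1 by blast
      have "n \<noteq> 0"
        using n that by (auto simp: complex_eq_iff)
      then have "1 * (2 * pi) \<le> \<bar>real_of_int n\<bar> * (2 * pi)"
        by (intro mult_right_mono) auto
      also have "\<dots> = \<bar>Im (g y - g x)\<bar>"
        by (simp only: n abs_mult) simp
      also have "\<dots> \<le> norm (g y - g x)"
        by (rule abs_Im_le_cmod)
      finally show ?thesis by simp
    qed
    then show "\<exists>e>0. \<forall>y. y \<in> UNIV \<and> g y \<noteq> g x \<longrightarrow> e \<le> norm (g y - g x)"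
      by (intro exI[of _ "2 * pi"]) auto
  qed simp
  then have "g 1 = g 0"
    by (auto simp: constant_on_def)
  moreover have "ray 0 = (\<lambda>j\<in>{..<k}. 0)" "ray 1 = \<theta>"
    using \<theta> by (auto simp: ray_def PiE_def extensional_def fun_eq_iff)
  ultimately show "\<psi> \<theta> = \<psi>' \<theta>"
    using assms by (simp add: g_def is_log_char_def)
qed

lemma log_char_eqI: "is_log_char M X k t \<psi> \<Longrightarrow> log_char M X k t = \<psi>"
  unfolding log_char_def is_log_char_def[symmetric]
  by (blast intro: is_log_char_unique)

text \<open>\<open>continuous_logarithm_on_contractible\<close> needs a normed space as domain, and the dimension \<open>k\<close> is not
  a type; so \<open>\<real>\<^sup>k\<close> is embedded into the bounded sequences, whatever \<open>k\<close> is.\<close>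

lemma is_log_char_exists:
  assumes "prob_space M" and meas: "\<And>j. j < k \<Longrightarrow> X (t j) \<in> borel_measurable M"
    and nonzero: "\<And>\<theta>. \<theta> \<in> Rvec k \<Longrightarrow> joint_char M X k t \<theta> \<noteq> 0"
  shows "\<exists>\<psi>. is_log_char M X k t \<psi>"
proof -
  interpret prob_space M by fact
  note [measurable] = meas
  \<comment> \<open>\<open>G\<close> extends the characteristic function to all bounded sequences
    through their first \<open>k\<close> coordinates, so it vanishes nowhere on a convex, hence
    contractible, space.\<close>
  define G where "G f = (LINT \<omega>|M. iexp (\<Sum>j<k. apply_bcontfun f j * X (t j) \<omega>))"
    for f :: "nat \<Rightarrow>\<^sub>C real"
  define e :: "nat \<Rightarrow> (nat \<Rightarrow>\<^sub>C real)" where "e j = Bcontfun (\<lambda>i. if i = j then 1 else 0)" for j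
  define emb where "emb \<theta> = (\<Sum>j<k. \<theta> j *\<^sub>R e j)" for \<theta>
  have e: "apply_bcontfun (e j) i = (if i = j then 1 else 0)" for i j
    unfolding e_def by (subst Bcontfun_inverse) (auto intro!: bcontfun_normI[of _ 1])
  have sum_app: "apply_bcontfun (\<Sum>j\<in>A. h j) i = (\<Sum>j\<in>A. apply_bcontfun (h j) i)"
    if "finite A" for A :: "nat set" and h :: "nat \<Rightarrow> nat \<Rightarrow>\<^sub>C real" and i
    using that by induction auto
  have emb: "apply_bcontfun (emb \<theta>) i = \<theta> i" if "i < k" for \<theta> i
    using that by (simp add: emb_def sum_app e if_distrib cong: if_cong)
  have "continuous_on UNIV G"
    unfolding continuous_on_sequentially
  proof safe
    fix x and a :: "nat \<Rightarrow>\<^sub>C real" assume "x \<longlonglongrightarrow> a"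
    then have "(\<lambda>m. apply_bcontfun (x m) j) \<longlonglongrightarrow> apply_bcontfun a j" for j
      by (intro tendsto_uniform_limitI[OF tendsto_bcontfun_uniform_limit]) auto
    then show "(G \<circ> x) \<longlonglongrightarrow> G a"
      unfolding o_def G_def
      by (intro integral_dominated_convergence[where w="\<lambda>_. 1"]) (auto intro!: tendsto_intros)
  qed
  moreover have "G f \<noteq> 0" for f
    using nonzero[of "\<lambda>j\<in>{..<k}. apply_bcontfun f j"] by (auto simp: G_def)
  ultimately obtain g where g: "continuous_on UNIV g" "\<And>f. G f = exp (g f)"
    using continuous_logarithm_on_contractible[of UNIV G] convex_imp_contractible[of UNIV] by auto
  \<comment> \<open>Subtracting \<open>g 0\<close> gives the value 0 at the origin; the exponential
    is unchanged because \<open>exp (g 0) = 1\<close>.\<close>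
  define \<psi> where "\<psi> = (\<lambda>\<theta>\<in>Rvec k. g (emb \<theta>) - g 0)"
  have proj: "((\<lambda>\<theta>. \<theta> j) \<longlongrightarrow> \<theta>0 j) (atin (Rvec_top k) \<theta>0)"
    if "j < k" "\<theta>0 \<in> Rvec k" for j and \<theta>0 :: "nat \<Rightarrow> real"
    using continuous_map_product_projection[of j "{..<k}" "\<lambda>_. euclideanreal"] that
    by (simp add: continuous_map_atin)
  have emb_cont: "(emb \<longlongrightarrow> emb \<theta>0) (atin (Rvec_top k) \<theta>0)" if "\<theta>0 \<in> Rvec k" for \<theta>0
    unfolding emb_def using that by (intro tendsto_sum tendsto_scaleR tendsto_const proj) auto
  have \<psi>_cont: "continuous_map (Rvec_top k) euclidean (\<lambda>\<theta>. g (emb \<theta>) - g 0)"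
    unfolding continuous_map_atin
  proof
    fix \<theta>0 assume "\<theta>0 \<in> topspace (Rvec_top k)"
    then have "(emb \<longlongrightarrow> emb \<theta>0) (atin (Rvec_top k) \<theta>0)"
      using emb_cont by simp
    then have "((\<lambda>\<theta>. g (emb \<theta>)) \<longlongrightarrow> g (emb \<theta>0)) (atin (Rvec_top k) \<theta>0)"
      using g(1) by (auto intro: isCont_tendsto_compose simp: continuous_on_eq_continuous_at)
    then show "limitin euclidean (\<lambda>\<theta>. g (emb \<theta>) - g 0) (g (emb \<theta>0) - g 0) (atin (Rvec_top k) \<theta>0)"
      by (auto intro!: tendsto_intros)
  qed
  have G: "G (emb \<theta>) = joint_char M X k t \<theta>" for \<theta>
    by (simp add: G_def emb)
  have "exp (g 0) = 1"
    using g(2)[of 0] by (simp add: G_def prob_space)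
  have "is_log_char M X k t \<psi>"
    unfolding is_log_char_def
  proof (intro conjI ballI)
    show "continuous_map (Rvec_top k) euclidean \<psi>"
      by (rule continuous_map_eq[OF \<psi>_cont]) (simp add: \<psi>_def)
    show "\<psi> (\<lambda>j\<in>{..<k}. 0) = 0"
      by (simp add: \<psi>_def emb_def)
    show "joint_char M X k t \<theta> = exp (\<psi> \<theta>)" if "\<theta> \<in> Rvec k" for \<theta>
      unfolding G[symmetric] g(2) using that by (simp add: \<psi>_def exp_diff \<open>exp (g 0) = 1\<close>)
  qed (simp add: \<psi>_def)
  then show ?thesis by blast
qed

section \<open>Infinitely divisible processes\<close>

text \<open>The functional x -> sum of \<theta>_j x_j carries a sum of n i.i.d. vectors to a sum of
  n i.i.d. real variables, so the one-dimensional image has n-th roots for every n.\<close>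

lemma infinitely_divisible_law_char_nonzero:
  assumes id: "infinitely_divisible_law k \<mu>"
  shows "char (distr \<mu> borel (\<lambda>x. \<Sum>j<k. \<theta> j * x j)) s \<noteq> 0"
proof (rule char_nonzero_if_roots)
  define L where "L x = (\<Sum>j<k. \<theta> j * x j)" for x :: "nat \<Rightarrow> real"
  have L[measurable]: "L \<in> borel_measurable (Rvec_borel k)"
    unfolding L_def by measurable
  \<comment> \<open>That \<open>\<mu>\<close> is a probability measure on
    \<open>Rvec_borel k\<close> is read off its representation as an image measure; the case
    \<open>n = 1\<close> supplies it below.\<close>
  have root: "prob_space \<mu> \<and> sets \<mu> = sets (Rvec_borel k) \<and>
      (\<exists>\<nu>. real_distribution \<nu> \<and> (\<forall>s. char (distr \<mu> borel L) s = char \<nu> s ^ n))"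
    if n: "n \<ge> 1" for n
  proof -
    obtain \<nu> where \<nu>: "prob_space \<nu>" and [measurable_cong]: "sets \<nu> = sets (Rvec_borel k)"
      and \<mu>: "\<mu> = distr (PiM {..<n} (\<lambda>_. \<nu>)) (Rvec_borel k) (\<lambda>w. \<lambda>j\<in>{..<k}. \<Sum>m<n. w m j)"
      using id[unfolded infinitely_divisible_law_def, rule_format, OF n] by (elim exE conjE)
    interpret \<nu>: prob_space \<nu> by fact
    interpret P: product_prob_space "\<lambda>_. \<nu>" "{..<n}" by standard
    have comp[measurable]: "(\<lambda>w. w m j) \<in> borel_measurable (PiM {..<n} (\<lambda>_. \<nu>))"
      if [simp]: "m < n" "j < k" for m j
    proof -
      have "(\<lambda>w. w m) \<in> PiM {..<n} (\<lambda>_. \<nu>) \<rightarrow>\<^sub>M Rvec_borel k"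
        by measurable
      then show ?thesis
        by (rule measurable_compose) simp
    qed
    have sum[measurable]: "(\<lambda>w. \<lambda>j\<in>{..<k}. \<Sum>m<n. w m j) \<in> PiM {..<n} (\<lambda>_. \<nu>) \<rightarrow>\<^sub>M Rvec_borel k"
      by (rule measurable_restrict) simp
    have [measurable]: "L \<in> borel_measurable \<nu>"
      by measurable
    have "char (distr \<mu> borel L) s = char (distr \<nu> borel L) s ^ n" for s
    proof -
      have "char (distr \<mu> borel L) s =
          (CLINT w|PiM {..<n} (\<lambda>_. \<nu>). iexp (s * L (\<lambda>j\<in>{..<k}. \<Sum>m<n. w m j)))"
        unfolding char_def \<mu> by (simp add: integral_distr)
      also have "\<dots> = (CLINT w|PiM {..<n} (\<lambda>_. \<nu>). \<Prod>m<n. iexp (s * L (w m)))"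
      proof (intro Bochner_Integration.integral_cong refl)
        fix w
        have "L (\<lambda>j\<in>{..<k}. \<Sum>m<n. w m j) = (\<Sum>m<n. L (w m))"
          unfolding L_def by (subst sum.swap) (simp add: sum_distrib_left)
        then show "iexp (s * L (\<lambda>j\<in>{..<k}. \<Sum>m<n. w m j)) = (\<Prod>m<n. iexp (s * L (w m)))"
          by (simp add: exp_sum[symmetric] sum_distrib_left)
      qed
      also have "\<dots> = (\<Prod>m<n. CLINT x|\<nu>. iexp (s * L x))"
        by (rule P.product_integral_prod) (auto intro!: \<nu>.integrable_iexp)
      finally show ?thesis
        by (simp add: char_def integral_distr)
    qed
    moreover have "real_distribution (distr \<nu> borel L)"
      by (rule \<nu>.real_distribution_distr) simp
    moreover have "prob_space \<mu>"
      unfolding \<mu> by (rule P.prob_space_distr) simp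
    moreover have "sets \<mu> = sets (Rvec_borel k)"
      by (simp add: \<mu>)
    ultimately show ?thesis
      by blast
  qed
  note [measurable_cong] = conjunct1[OF conjunct2[OF root[OF order_refl]]]
  interpret \<mu>: prob_space \<mu>
    using root[of 1] by simp
  show "real_distribution (distr \<mu> borel (\<lambda>x. \<Sum>j<k. \<theta> j * x j))"
    by (rule \<mu>.real_distribution_distr) simp
  show "\<exists>\<nu>. real_distribution \<nu> \<and> (\<forall>s. char (distr \<mu> borel (\<lambda>x. \<Sum>j<k. \<theta> j * x j)) s = char \<nu> s ^ n)"
    if "n \<ge> 1" for n
    using root[OF that] by (simp add: L_def[abs_def])
qed

text \<open>A diagonal linear map commutes with sums, so it may be applied to each i.i.d. summand.
  Coefficients 0 are allowed, which later handles coordinates at time 0.\<close>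

lemma infinitely_divisible_law_scale:
  assumes id: "infinitely_divisible_law k \<mu>"
  shows "infinitely_divisible_law k (distr \<mu> (Rvec_borel k) (\<lambda>x. \<lambda>j\<in>{..<k}. c j * x j))"
  unfolding infinitely_divisible_law_def
proof (intro allI impI)
  fix n :: nat assume n: "n \<ge> 1"
  obtain \<nu> where \<nu>: "prob_space \<nu>" and [measurable_cong]: "sets \<nu> = sets (Rvec_borel k)"
    and \<mu>: "\<mu> = distr (PiM {..<n} (\<lambda>_. \<nu>)) (Rvec_borel k) (\<lambda>w. \<lambda>j\<in>{..<k}. \<Sum>m<n. w m j)"
    using id[unfolded infinitely_divisible_law_def, rule_format, OF n] by (elim exE conjE)
  interpret \<nu>: prob_space \<nu> by fact
  define h where "h x = (\<lambda>j\<in>{..<k}. c j * x j)" for x :: "nat \<Rightarrow> real"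
  have h[measurable]: "h \<in> \<nu> \<rightarrow>\<^sub>M Rvec_borel k"
    unfolding h_def by measurable
  have h'[measurable]: "h \<in> Rvec_borel k \<rightarrow>\<^sub>M Rvec_borel k"
    unfolding h_def by measurable
  have sum[measurable]: "(\<lambda>w. \<lambda>j\<in>{..<k}. \<Sum>m<n. w m j) \<in> PiM {..<n} (\<lambda>_. Rvec_borel k) \<rightarrow>\<^sub>M Rvec_borel k"
  proof (intro measurable_restrict borel_measurable_sum)
    fix m j assume "m \<in> {..<n}" "j \<in> {..<k}"
    then have "(\<lambda>w. w m) \<in> PiM {..<n} (\<lambda>_. Rvec_borel k) \<rightarrow>\<^sub>M Rvec_borel k"
      by (rule_tac measurable_component_singleton)
    then show "(\<lambda>w. w m j) \<in> borel_measurable (PiM {..<n} (\<lambda>_. Rvec_borel k))"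
      by (rule measurable_compose) (use \<open>j \<in> _\<close> in simp)
  qed
  have cong: "sets (PiM {..<n} (\<lambda>_. \<nu>)) = sets (PiM {..<n} (\<lambda>_. Rvec_borel k))"
    by (rule sets_PiM_cong) (simp_all add: \<open>sets \<nu> = _\<close>)
  have sum'[measurable]: "(\<lambda>w. \<lambda>j\<in>{..<k}. \<Sum>m<n. w m j) \<in> PiM {..<n} (\<lambda>_. \<nu>) \<rightarrow>\<^sub>M Rvec_borel k"
    using sum unfolding measurable_cong_sets[OF cong refl] .
  have comp[measurable]: "compose {..<n} h \<in> PiM {..<n} (\<lambda>_. \<nu>) \<rightarrow>\<^sub>M PiM {..<n} (\<lambda>_. Rvec_borel k)"
    unfolding compose_def by measurable
  have "distr (PiM {..<n} (\<lambda>_. distr \<nu> (Rvec_borel k) h)) (Rvec_borel k) (\<lambda>w. \<lambda>j\<in>{..<k}. \<Sum>m<n. w m j)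
      = distr (distr (PiM {..<n} (\<lambda>_. \<nu>)) (PiM {..<n} (\<lambda>_. Rvec_borel k)) (compose {..<n} h))
          (Rvec_borel k) (\<lambda>w. \<lambda>j\<in>{..<k}. \<Sum>m<n. w m j)"
  proof -
    \<comment> \<open>The image of the product under \<open>h\<close> in every component is first
      taken with \<open>\<nu>\<close> as target; replacing the target by \<open>Rvec_borel k\<close>
      is harmless since the sigma-algebras agree.\<close>
    have "distr (PiM {..<n} (\<lambda>_. \<nu>)) (PiM {..<n} (\<lambda>_. \<nu>)) (compose {..<n} h) = PiM {..<n} (\<lambda>_. distr \<nu> \<nu> h)"
      by (rule distr_PiM_finite_prob_space') (auto simp: \<nu>)
    moreover have "distr \<nu> \<nu> h = distr \<nu> (Rvec_borel k) h"
      by (rule distr_cong) (simp_all add: \<open>sets \<nu> = _\<close>)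
    moreover have "distr (PiM {..<n} (\<lambda>_. \<nu>)) (PiM {..<n} (\<lambda>_. \<nu>)) (compose {..<n} h) =
        distr (PiM {..<n} (\<lambda>_. \<nu>)) (PiM {..<n} (\<lambda>_. Rvec_borel k)) (compose {..<n} h)"
      by (rule distr_cong) (simp_all add: cong)
    ultimately show ?thesis by simp
  qed
  also have "\<dots> = distr \<mu> (Rvec_borel k) h"
    unfolding \<mu> by (subst (1 2) distr_distr)
      (auto simp: h_def compose_def sum_distrib_left fun_eq_iff intro!: distr_cong)
  finally show "\<exists>\<nu>. prob_space \<nu> \<and> sets \<nu> = sets (Rvec_borel k) \<and>
      distr \<mu> (Rvec_borel k) (\<lambda>x. \<lambda>j\<in>{..<k}. c j * x j) =
        distr (PiM {..<n} (\<lambda>_. \<nu>)) (Rvec_borel k) (\<lambda>w. \<lambda>j\<in>{..<k}. \<Sum>m<n. w m j)"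
    by (intro exI[of _ "distr \<nu> (Rvec_borel k) h"])
       (auto simp: h_def[abs_def] intro!: \<nu>.prob_space_distr h[unfolded h_def[abs_def]])
qed

lemma measurable_fdd:
  assumes "real_process M T X" "t \<in> {..<k} \<rightarrow> T"
  shows "(\<lambda>\<omega>. \<lambda>j\<in>{..<k}. X (t j) \<omega>) \<in> M \<rightarrow>\<^sub>M Rvec_borel k"
  using assms by (intro measurable_restrict) (auto simp: real_process_def Pi_iff)

text \<open>Makes the description in \<open>log_char\<close> meaningful: the joint characteristic
  function at \<theta> is the one-dimensional one of the \<theta>-combination at 1, hence
  nonzero.\<close>

lemma is_log_char_log_char:
  assumes X: "infinitely_divisible M T X" and t: "t \<in> {..<k} \<rightarrow> T"
  shows "is_log_char M X k t (log_char M X k t)"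
proof -
  have rp: "real_process M T X" and id: "infinitely_divisible_law k (fdd M X k t)"
    using assms by (auto simp: infinitely_divisible_def)
  have "joint_char M X k t \<theta> \<noteq> 0" for \<theta>
  proof -
    have "joint_char M X k t \<theta> = char (distr (fdd M X k t) borel (\<lambda>x. \<Sum>j<k. \<theta> j * x j)) 1"
      unfolding char_def fdd_def
      by (simp add: integral_distr measurable_fdd[OF rp t] del: of_real_sum)
    then show ?thesis
      using infinitely_divisible_law_char_nonzero[OF id] by metis
  qed
  then obtain \<psi> where "is_log_char M X k t \<psi>"
    using is_log_char_exists[of M k X t] rp t by (auto simp: real_process_def Pi_iff)
  then show ?thesis
    by (simp add: log_char_eqI)
qed

text \<open>The factors \<open>c j\<close> can be moved from the coordinates onto \<theta>. With
  values 0 and 1 this deletes exactly the coordinates at which a process is set to 0.\<close>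

lemma log_char_scale:
  assumes "is_log_char M Y k u \<psi>" and X: "\<And>j. j < k \<Longrightarrow> X (t j) = (\<lambda>\<omega>. c j * Y (u j) \<omega>)"
  shows "log_char M X k t = (\<lambda>\<theta>\<in>Rvec k. \<psi> (\<lambda>j\<in>{..<k}. c j * \<theta> j))"
proof (rule log_char_eqI)
  have "continuous_map (Rvec_top k) (Rvec_top k) (\<lambda>\<theta>. \<lambda>j\<in>{..<k}. c j * \<theta> j)"
    unfolding continuous_map_componentwise
    by (auto intro!: continuous_map_real_mult continuous_map_product_projection)
  then have "continuous_map (Rvec_top k) euclidean (\<psi> \<circ> (\<lambda>\<theta>. \<lambda>j\<in>{..<k}. c j * \<theta> j))"
    using assms(1) unfolding is_log_char_def by (blast intro: continuous_map_compose)
  then have "continuous_map (Rvec_top k) euclidean (\<lambda>\<theta>\<in>Rvec k. \<psi> (\<lambda>j\<in>{..<k}. c j * \<theta> j))"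
    by (rule continuous_map_eq) auto
  moreover have "joint_char M X k t \<theta> = exp (\<psi> (\<lambda>j\<in>{..<k}. c j * \<theta> j))" if "\<theta> \<in> Rvec k" for \<theta>
  proof -
    have "joint_char M X k t \<theta> = joint_char M Y k u (\<lambda>j\<in>{..<k}. c j * \<theta> j)"
      by (simp add: X mult_ac)
    also have "(\<lambda>j\<in>{..<k}. c j * \<theta> j) \<in> Rvec k"
      by auto
    then have "joint_char M Y k u (\<lambda>j\<in>{..<k}. c j * \<theta> j) = exp (\<psi> (\<lambda>j\<in>{..<k}. c j * \<theta> j))"
      using assms(1) unfolding is_log_char_def by blast
    finally show ?thesis .
  qed
  moreover have "\<psi> (\<lambda>j\<in>{..<k}. c j * (\<lambda>j\<in>{..<k}. 0) j) = 0"
    using assms by (simp add: is_log_char_def cong: restrict_cong)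
  ultimately show "is_log_char M X k t (\<lambda>\<theta>\<in>Rvec k. \<psi> (\<lambda>j\<in>{..<k}. c j * \<theta> j))"
    by (simp add: is_log_char_def)
qed

lemma infinitely_divisible_scale:
  assumes Y: "infinitely_divisible M S Y" and u: "\<And>t. t \<in> T \<Longrightarrow> u t \<in> S"
    and X: "\<And>t. t \<in> T \<Longrightarrow> X t = (\<lambda>\<omega>. c t * Y (u t) \<omega>)"
  shows "infinitely_divisible M T X"
  unfolding infinitely_divisible_def
proof (intro conjI allI ballI)
  have rp: "real_process M S Y"
    using Y by (simp add: infinitely_divisible_def)
  then show "real_process M T X"
    using u X by (auto simp: real_process_def intro!: borel_measurable_times)
  fix k :: nat and t assume t: "t \<in> {..<k} \<rightarrow> T"
  then have u': "(\<lambda>j. u (t j)) \<in> {..<k} \<rightarrow> S"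
    using u by auto
  have "fdd M X k t =
      distr (fdd M Y k (\<lambda>j. u (t j))) (Rvec_borel k) (\<lambda>x. \<lambda>j\<in>{..<k}. c (t j) * x j)"
  proof -
    have "X (t j) = (\<lambda>\<omega>. c (t j) * Y (u (t j)) \<omega>)" if "j < k" for j
      \<comment> \<open>The vector of \<open>X\<close> is thus a diagonal image of a vector of
        \<open>Y\<close> at changed times.\<close>
      using X t that by blast
    then show ?thesis
      unfolding fdd_def
      by (subst distr_distr) (auto intro!: distr_cong measurable_fdd[OF rp u'])
  qed
  moreover have "infinitely_divisible_law k (fdd M Y k (\<lambda>j. u (t j)))"
    using Y u' unfolding infinitely_divisible_def by blast
  ultimately show "infinitely_divisible_law k (fdd M X k t)"
    using infinitely_divisible_law_scale by metis
qed

section \<open>Scaling of time\<close>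

text \<open>Common core of both notions: p = 1 / \<delta> gives \<open>time_stable\<close> up to
  stochastic continuity, and p = 1 gives \<open>IDT\<close>.\<close>

definition time_scaling :: "real \<Rightarrow> 'a measure \<Rightarrow> (real \<Rightarrow> 'a \<Rightarrow> real) \<Rightarrow> bool" where
  "time_scaling p M X \<longleftrightarrow>
     infinitely_divisible M {0..} X \<and>
     (\<forall>n::nat. n \<ge> 1 \<longrightarrow> (\<forall>k. \<forall>t\<in>{..<k} \<rightarrow> {0..}. \<forall>\<theta>\<in>Rvec k.
        log_char M X k (\<lambda>j. real n powr p * t j) \<theta> = of_nat n * log_char M X k t \<theta>))"

lemma time_scalingD:
  assumes "time_scaling p M X" "n \<ge> 1" "t \<in> {..<k} \<rightarrow> {0..}" "\<theta> \<in> Rvec k"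
  shows "log_char M X k (\<lambda>j. real n powr p * t j) \<theta> = of_nat n * log_char M X k t \<theta>"
  using assms unfolding time_scaling_def by blast

text \<open>Both integer relations are applied to the times \<open>u\<close> for the factor 1 / m:
  scaling by m leads back to t, scaling by n leads to the factor n / m.\<close>

lemma time_scaling_rational:
  assumes X: "time_scaling p M X" and nm: "n \<ge> 1" "m \<ge> 1"
    and t: "t \<in> {..<k} \<rightarrow> {0..}" and \<theta>: "\<theta> \<in> Rvec k"
  shows "log_char M X k (\<lambda>j. (real n / real m) powr p * t j) \<theta>
    = of_real (real n / real m) * log_char M X k t \<theta>"
proof -
  define u where "u j = (1 / real m) powr p * t j" for j
  have u: "u \<in> {..<k} \<rightarrow> {0..}"
    using t by (auto simp: u_def intro!: mult_nonneg_nonneg)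
  have "real l powr p * u j = (real l / real m) powr p * t j" for l j
    by (simp add: u_def powr_mult[symmetric])
  from this[of m] this[of n] nm
  have "(\<lambda>j. real m powr p * u j) = t"
    and un: "(\<lambda>j. (real n / real m) powr p * t j) = (\<lambda>j. real n powr p * u j)"
    by auto
  then have "log_char M X k t \<theta> = of_nat m * log_char M X k u \<theta>"
    using time_scalingD[OF X nm(2) u \<theta>] by simp
  then show ?thesis
    unfolding un using time_scalingD[OF X nm(1) u \<theta>] nm by simp
qed

text \<open>The approximation is strictly from above to match right limits along s_i > t_i.\<close>

lemma rational_approx_right:
  fixes c :: real
  assumes "c > 0"
  obtains n m :: "nat \<Rightarrow> nat" where "\<And>i. n i \<ge> 1" "\<And>i. m i \<ge> 1" "\<And>i. real (n i) / real (m i) > c"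
    "(\<lambda>i. real (n i) / real (m i)) \<longlonglongrightarrow> c"
proof
  \<comment> \<open>Over the denominator \<open>Suc i\<close>, floor plus one is the least numerator
    exceeding \<open>c * Suc i\<close>, and it overshoots by at most 1.\<close>
  define n where "n i = nat \<lfloor>c * real (Suc i)\<rfloor> + 1" for i
  have n: "c * real (Suc i) < real (n i)" "real (n i) \<le> c * real (Suc i) + 1" for i
    using assms unfolding n_def by (auto simp: mult_less_0_iff) linarith+
  show lower: "c < real (n i) / real (Suc i)" for i
    using n(1)[of i] by (simp add: pos_less_divide_eq)
  have upper: "real (n i) / real (Suc i) \<le> c + 1 / real (Suc i)" for i
    using divide_right_mono[OF n(2), of "real (Suc i)" i] by (simp add: add_divide_distrib)
  have "(\<lambda>i. c + 1 / real (Suc i)) \<longlonglongrightarrow> c"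
    using tendsto_add[OF tendsto_const[of c] LIMSEQ_Suc[OF lim_inverse_n']] by simp
  then show "(\<lambda>i. real (n i) / real (Suc i)) \<longlonglongrightarrow> c"
    by (rule real_tendsto_sandwich[where f = "\<lambda>_. c", rotated 3, OF _ ])
       (simp_all only: upper less_imp_le[OF lower] eventually_True tendsto_const)
  show "n i \<ge> 1" for i
    by (simp add: n_def)
qed simp

text \<open>Only pointwise convergence of the characteristic functions is needed: along rational
  \<open>q \<longlonglongrightarrow> c\<close> they are \<open>exp (q * \<psi> \<theta>)\<close>, hence the limit is \<open>exp (c * \<psi> \<theta>)\<close>, and its continuous
  logarithm is unique.\<close>

lemma time_scaling_real:
  assumes X: "time_scaling p M X" and c: "c > 0"
    and t: "t \<in> {..<k} \<rightarrow> {0..}" and \<theta>: "\<theta> \<in> Rvec k"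
    and conv: "\<And>q \<theta>. (\<And>i. q i > c) \<Longrightarrow> q \<longlonglongrightarrow> c \<Longrightarrow> \<theta> \<in> Rvec k \<Longrightarrow>
      (\<lambda>i. joint_char M X k (\<lambda>j. q i powr p * t j) \<theta>) \<longlonglongrightarrow> joint_char M X k (\<lambda>j. c powr p * t j) \<theta>"
  shows "log_char M X k (\<lambda>j. c powr p * t j) \<theta> = of_real c * log_char M X k t \<theta>"
proof -
  define \<psi> where "\<psi> = log_char M X k t"
  have id: "infinitely_divisible M {0..} X"
    using X by (simp add: time_scaling_def)
  have \<psi>: "is_log_char M X k t \<psi>"
    unfolding \<psi>_def by (rule is_log_char_log_char[OF id t])
  obtain n m where nm: "\<And>i. n i \<ge> 1" "\<And>i. m i \<ge> 1" "\<And>i. real (n i) / real (m i) > c"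
    "(\<lambda>i. real (n i) / real (m i)) \<longlonglongrightarrow> c"
    using rational_approx_right[OF c] by blast
  \<comment> \<open>Needed at every \<theta>, not just the fixed one, since uniqueness of the
    logarithm concerns whole functions.\<close>
  have char_c: "joint_char M X k (\<lambda>j. c powr p * t j) \<theta> = exp (of_real c * \<psi> \<theta>)"
    if \<theta>: "\<theta> \<in> Rvec k" for \<theta>
  proof (rule LIMSEQ_unique[OF conv[OF nm(3,4) \<theta>]])
    have "joint_char M X k (\<lambda>j. (real (n i) / real (m i)) powr p * t j) \<theta>
        = exp (of_real (real (n i) / real (m i)) * \<psi> \<theta>)" for i
    proof -
      have "(\<lambda>j. (real (n i) / real (m i)) powr p * t j) \<in> {..<k} \<rightarrow> {0..}"
        using t by (auto intro!: mult_nonneg_nonneg)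
      then have "is_log_char M X k (\<lambda>j. (real (n i) / real (m i)) powr p * t j)
          (log_char M X k (\<lambda>j. (real (n i) / real (m i)) powr p * t j))"
        by (rule is_log_char_log_char[OF id])
      then have "joint_char M X k (\<lambda>j. (real (n i) / real (m i)) powr p * t j) \<theta>
          = exp (log_char M X k (\<lambda>j. (real (n i) / real (m i)) powr p * t j) \<theta>)"
        using \<theta> unfolding is_log_char_def by blast
      then show ?thesis
        unfolding time_scaling_rational[OF X nm(1,2) t \<theta>] \<psi>_def .
    qed
    moreover have "(\<lambda>i. exp (of_real (real (n i) / real (m i)) * \<psi> \<theta>)) \<longlonglongrightarrow> exp (of_real c * \<psi> \<theta>)"
      by (intro tendsto_exp tendsto_mult tendsto_const tendsto_of_real nm(4))
    ultimately show "(\<lambda>i. joint_char M X k (\<lambda>j. (real (n i) / real (m i)) powr p * t j) \<theta>)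
        \<longlonglongrightarrow> exp (of_real c * \<psi> \<theta>)"
      by (simp only:)
  qed
  have "continuous_map (Rvec_top k) euclidean \<psi>"
    using \<psi> by (simp add: is_log_char_def)
  then have "continuous_map (Rvec_top k) euclidean (\<lambda>\<theta>. of_real c * \<psi> \<theta>)"
    unfolding continuous_map_atin limitin_canonical_iff
    by (intro ballI tendsto_mult_left) (erule (1) bspec)
  then have "continuous_map (Rvec_top k) euclidean (\<lambda>\<theta>\<in>Rvec k. of_real c * \<psi> \<theta>)"
    by (rule continuous_map_eq) simp
  then have "is_log_char M X k (\<lambda>j. c powr p * t j) (\<lambda>\<theta>\<in>Rvec k. of_real c * \<psi> \<theta>)"
    using \<psi> char_c by (simp add: is_log_char_def)
  then show ?thesis
    using \<theta> by (simp add: log_char_eqI \<psi>_def)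
qed

text \<open>A shift of t by T multiplies the time by \<open>exp (\<delta> * T) powr p\<close>, so
  this is scaling with c = exp(\<delta> T). All times involved are positive, and \<open>conv\<close>
  is where the two continuity assumptions enter.\<close>

lemma translatively_stable_exp:
  assumes X: "time_scaling p M X"
    and conv: "\<And>k q c t \<theta>. (\<And>j. t j > 0) \<Longrightarrow> c > 0 \<Longrightarrow> (\<And>i. q i > c) \<Longrightarrow> q \<longlonglongrightarrow> c \<Longrightarrow> \<theta> \<in> Rvec k \<Longrightarrow>
      (\<lambda>i. joint_char M X k (\<lambda>j. q i powr p * t j) \<theta>) \<longlonglongrightarrow> joint_char M X k (\<lambda>j. c powr p * t j) \<theta>"
  shows "translatively_stable \<delta> M (\<lambda>t. X (exp (\<delta> * p * t)))"
  unfolding translatively_stable_def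
proof (intro conjI allI ballI)
  show "infinitely_divisible M UNIV (\<lambda>t. X (exp (\<delta> * p * t)))"
    by (rule infinitely_divisible_scale[of M "{0..}" X _ "\<lambda>t. exp (\<delta> * p * t)" _ "\<lambda>_. 1"])
       (use X in \<open>auto simp: time_scaling_def\<close>)
  fix T :: real and k :: nat and t :: "nat \<Rightarrow> real" and \<theta> assume \<theta>: "\<theta> \<in> Rvec k"
  have shift: "exp (\<delta> * p * (t j + T)) = exp (\<delta> * T) powr p * exp (\<delta> * p * t j)" for j
    by (simp add: powr_def exp_add[symmetric] algebra_simps)
  have "log_char M X k (\<lambda>j. exp (\<delta> * T) powr p * exp (\<delta> * p * t j)) \<theta>
      = of_real (exp (\<delta> * T)) * log_char M X k (\<lambda>j. exp (\<delta> * p * t j)) \<theta>"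
    by (rule time_scaling_real[OF X _ _ \<theta> conv]) auto
  then show "log_char M (\<lambda>t. X (exp (\<delta> * p * t))) k (\<lambda>j. t j + T) \<theta>
      = of_real (exp (\<delta> * T)) * log_char M (\<lambda>t. X (exp (\<delta> * p * t))) k t \<theta>"
    by (simp only: log_char_def shift)
qed

text \<open>The time factor n^p becomes the shift a p ln n, which contributes exp(\<delta> a p ln n)
  = n. Part (a) takes a = 1, p = 1 / \<delta>; part (b) takes a = 1 / \<delta>, p = 1.\<close>

lemma time_scaling_ln:
  assumes V: "translatively_stable \<delta> M V" and "\<delta> * a * p = 1"
  shows "time_scaling p M (\<lambda>t. if t = 0 then (\<lambda>_. 0) else V (a * ln t))" (is "time_scaling p M ?D")
  unfolding time_scaling_def
proof (intro conjI allI ballI impI)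
  have id: "infinitely_divisible M UNIV V"
    using V by (simp add: translatively_stable_def)
  show "infinitely_divisible M {0..} ?D"
    by (rule infinitely_divisible_scale[OF id, of _ "\<lambda>t. a * ln t" _ "\<lambda>t. if t = 0 then 0 else 1"]) auto
  fix n k :: nat and t :: "nat \<Rightarrow> real" and \<theta> assume n: "n \<ge> 1" and t: "t \<in> {..<k} \<rightarrow> {0..}" and \<theta>: "\<theta> \<in> Rvec k"
  define T where "T = a * (p * ln (real n))"
  define u where "u j = a * ln (t j)" for j
  \<comment> \<open>As \<open>real n powr p\<close> is positive, the same \<open>c\<close> marks the
    zero times before and after scaling.\<close>
  define c :: "nat \<Rightarrow> real" where "c j = (if t j = 0 then 0 else 1)" for j
  have log_char_V: "is_log_char M V k u (log_char M V k u)" for u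
    by (rule is_log_char_log_char[OF id]) simp
  have "exp (\<delta> * T) = real n"
    using n assms(2) by (simp add: T_def mult.assoc[symmetric])
  have scaled: "log_char M ?D k (\<lambda>j. real n powr p * t j)
      = (\<lambda>\<theta>\<in>Rvec k. log_char M V k (\<lambda>j. u j + T) (\<lambda>j\<in>{..<k}. c j * \<theta> j))"
  proof (rule log_char_scale[OF log_char_V])
    fix j assume "j < k"
    then have "t j \<ge> 0"
      using t by auto
    then show "?D (real n powr p * t j) = (\<lambda>\<omega>. c j * V (u j + T) \<omega>)"
      using n by (auto simp: c_def u_def T_def ln_mult ln_powr algebra_simps)
  qed
  have "log_char M ?D k (\<lambda>j. real n powr p * t j) \<theta>
      = of_nat n * log_char M V k u (\<lambda>j\<in>{..<k}. c j * \<theta> j)"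
  proof -
    have "(\<lambda>j\<in>{..<k}. c j * \<theta> j) \<in> Rvec k"
      by auto
    then have "log_char M V k (\<lambda>j. u j + T) (\<lambda>j\<in>{..<k}. c j * \<theta> j)
        = of_real (exp (\<delta> * T)) * log_char M V k u (\<lambda>j\<in>{..<k}. c j * \<theta> j)"
      using V unfolding translatively_stable_def by blast
    then show ?thesis
      unfolding scaled using \<theta> \<open>exp (\<delta> * T) = real n\<close> by simp
  qed
  also have "log_char M V k u (\<lambda>j\<in>{..<k}. c j * \<theta> j) = log_char M ?D k t \<theta>"
  proof -
    have "log_char M ?D k t = (\<lambda>\<theta>\<in>Rvec k. log_char M V k u (\<lambda>j\<in>{..<k}. c j * \<theta> j))"
      by (rule log_char_scale[OF log_char_V]) (simp add: u_def c_def)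
    then show ?thesis
      using \<theta> by simp
  qed
  finally show "log_char M ?D k (\<lambda>j. real n powr p * t j) \<theta> = of_nat n * log_char M ?D k t \<theta>" .
qed

text \<open>At t > 0 continuity of the logarithm transfers the limit; at 0 the logarithm tends to
  minus infinity, where \<open>bot\<close> supplies it.\<close>

lemma stochastically_continuous_ln:
  assumes cont: "stochastically_continuous M UNIV V" and bot: "tends_in_prob M V (\<lambda>_. 0) at_bot"
  shows "stochastically_continuous M {0..} (\<lambda>t. if t = 0 then (\<lambda>_. 0) else V (ln t))"
  unfolding stochastically_continuous_def tends_in_prob_def
proof (intro ballI allI impI)
  fix t \<epsilon> :: real assume t: "t \<in> {0..}" and \<epsilon>: "\<epsilon> > 0"
  define Y where "Y = (if t = 0 then (\<lambda>_. 0) else V (ln t))"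
  define F where "F = (if t = 0 then at_bot else at (ln t))"
  have "((\<lambda>s. measure M {\<omega>\<in>space M. \<bar>V s \<omega> - Y \<omega>\<bar> > \<epsilon>}) \<longlongrightarrow> 0) F"
    using cont bot \<epsilon> by (simp add: Y_def F_def stochastically_continuous_def tends_in_prob_def)
  moreover have pos: "\<forall>\<^sub>F s in at t within {0..}. s > 0"
  proof (cases "t = 0")
    case True
    then show ?thesis
      by (simp add: eventually_at_filter)
  next
    case False
    then show ?thesis
      using t by (intro order_tendstoD(1)[OF tendsto_ident_at]) auto
  qed
  have "filterlim ln F (at t within {0..})"
  proof (cases "t = 0")
    case True
    then show ?thesis
      by (simp add: F_def at_within_Ici_at_right ln_at_0)
  next
    case False
    have "(ln \<longlongrightarrow> ln t) (at t within {0..})"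
      using False by (intro tendsto_intros)
    \<comment> \<open>\<open>at (ln t)\<close> is punctured, so injectivity of \<open>ln\<close> on
      positive reals is required besides its continuity.\<close>
    moreover have "\<forall>\<^sub>F s in at t within {0..}. ln s \<noteq> ln t"
      using eventually_neq_at_within[of t t "{0..}"] pos by eventually_elim (use t False in auto)
    ultimately show ?thesis
      using False by (simp add: F_def filterlim_at)
  qed
  ultimately have "((\<lambda>s. measure M {\<omega>\<in>space M. \<bar>V (ln s) \<omega> - Y \<omega>\<bar> > \<epsilon>}) \<longlongrightarrow> 0) (at t within {0..})"
    by (rule filterlim_compose)
  then show "((\<lambda>s. measure M {\<omega>\<in>space M. \<bar>(if s = 0 then (\<lambda>_. 0) else V (ln s)) \<omega>
      - (if t = 0 then (\<lambda>_. 0) else V (ln t)) \<omega>\<bar> > \<epsilon>}) \<longlongrightarrow> 0) (at t within {0..})"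
    unfolding Y_def by (rule Lim_transform_eventually) (use pos in eventually_elim, simp)
qed

section \<open>Convergence of characteristic functions\<close>

text \<open>Real and imaginary parts are integrals of the cosine and sine of a linear form, which
  are bounded and continuous test functions.\<close>

lemma vec_weakly_converges_joint_char:
  assumes conv: "vec_weakly_converges k (\<lambda>m. fdd M X k (u m)) (fdd M X k v)"
    and rp: "real_process M T X" and u: "\<And>m. u m \<in> {..<k} \<rightarrow> T" and v: "v \<in> {..<k} \<rightarrow> T"
  shows "(\<lambda>m. joint_char M X k (u m) \<theta>) \<longlonglongrightarrow> joint_char M X k v \<theta>"
proof -
  interpret prob_space M
    using rp by (simp add: real_process_def)
  define L where "L x = (\<Sum>j<k. \<theta> j * x j)" for x :: "nat \<Rightarrow> real"
  have L[measurable]: "L \<in> borel_measurable (Rvec_borel k)"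
    unfolding L_def by measurable
  have L_cont: "continuous_map (Rvec_top k) euclideanreal L"
    unfolding L_def
    by (intro continuous_map_sum continuous_map_real_mult continuous_map_product_projection) auto
  have char_fdd: "joint_char M X k t \<theta>
      = Complex (LINT x|fdd M X k t. cos (L x)) (LINT x|fdd M X k t. sin (L x))"
    if t: "t \<in> {..<k} \<rightarrow> T" for t
  proof -
    note [measurable] = measurable_fdd[OF rp t]
    define Y where "Y \<omega> = L (\<lambda>j\<in>{..<k}. X (t j) \<omega>)" for \<omega>
    have [measurable]: "Y \<in> borel_measurable M"
      unfolding Y_def by measurable
    have int: "integrable M (\<lambda>\<omega>. iexp (Y \<omega>))"
      by (rule integrable_iexp) auto
    have "joint_char M X k t \<theta> = (CLINT \<omega>|M. iexp (Y \<omega>))"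
      by (simp add: Y_def L_def)
    also have "\<dots> = Complex (LINT \<omega>|M. cos (Y \<omega>)) (LINT \<omega>|M. sin (Y \<omega>))"
      by (rule complex_eqI) (simp_all add: int Re_exp Im_exp flip: integral_Re integral_Im)
    finally show ?thesis
      by (simp add: fdd_def integral_distr Y_def)
  qed
  have "(\<lambda>m. LINT x|fdd M X k (u m). f (L x)) \<longlonglongrightarrow> (LINT x|fdd M X k v. f (L x))"
    if f: "continuous_on UNIV f" "\<And>y. \<bar>f y\<bar> \<le> 1" for f :: "real \<Rightarrow> real"
  proof -
    have "continuous_map (Rvec_top k) euclideanreal (\<lambda>x. f (L x))"
      using continuous_map_compose[OF L_cont, of euclideanreal f] f(1) by (simp add: o_def)
    moreover have "bounded ((\<lambda>x. f (L x)) ` Rvec k)"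
      using f(2) by (auto intro!: boundedI[of _ 1])
    ultimately show ?thesis
      using conv unfolding vec_weakly_converges_def by blast
  qed
  from this[of cos] this[of sin] show ?thesis
    unfolding char_fdd[OF u] char_fdd[OF v]
    by (intro tendsto_Complex) (simp_all add: continuous_on_cos continuous_on_sin)
qed

text \<open>The integrand is at most |c| \<epsilon> where |Y - Z| <= \<epsilon>, and at most 2 on
  the remaining event, whose probability tends to 0.\<close>

lemma (in prob_space) tendsto_in_prob_iexp:
  fixes Y :: "nat \<Rightarrow> 'a \<Rightarrow> real"
  assumes [measurable]: "\<And>m. Y m \<in> borel_measurable M" "Z \<in> borel_measurable M"
    and conv: "\<And>\<epsilon>. \<epsilon> > 0 \<Longrightarrow> (\<lambda>m. prob {\<omega>\<in>space M. \<bar>Y m \<omega> - Z \<omega>\<bar> > \<epsilon>}) \<longlonglongrightarrow> 0"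
  shows "(\<lambda>m. LINT \<omega>|M. cmod (iexp (c * Y m \<omega>) - iexp (c * Z \<omega>))) \<longlonglongrightarrow> 0"
proof (rule tendstoI)
  fix e :: real assume e: "e > 0"
  \<comment> \<open>The summand 1 keeps the denominator positive for c = 0; the first error is then
    below e / 2, and probabilities below e / 4 keep the second below e / 2.\<close>
  define \<epsilon> where "\<epsilon> = e / (2 * (\<bar>c\<bar> + 1))"
  have \<epsilon>: "\<epsilon> > 0" "\<bar>c\<bar> * \<epsilon> < e / 2"
    using e by (auto simp: \<epsilon>_def field_simps)
  define A where "A m = {\<omega>\<in>space M. \<bar>Y m \<omega> - Z \<omega>\<bar> > \<epsilon>}" for m
  have [measurable]: "A m \<in> events" for m
    unfolding A_def by measurable
  have bound: "cmod (iexp x - iexp y) \<le> \<bar>x - y\<bar>" "cmod (iexp x - iexp y) \<le> 2" for x y :: real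
  proof -
    have "iexp x - iexp y = iexp y * (iexp (x - y) - 1)"
      by (simp add: algebra_simps flip: exp_add)
    then have "cmod (iexp x - iexp y) = 2 * \<bar>sin ((x - y) / 2)\<bar>"
      using dist_exp_i_1[of "x - y"] by (simp add: norm_mult)
    then show "cmod (iexp x - iexp y) \<le> \<bar>x - y\<bar>" "cmod (iexp x - iexp y) \<le> 2"
      using abs_sin_x_le_abs_x[of "(x - y) / 2"] abs_sin_le_one[of "(x - y) / 2"] by auto
  qed
  have int: "integrable M (\<lambda>\<omega>. cmod (iexp (c * Y m \<omega>) - iexp (c * Z \<omega>)))" for m
    by (rule integrable_const_bound[of _ 2]) (use bound(2) in \<open>auto simp del: of_real_mult\<close>)
  have le: "(LINT \<omega>|M. cmod (iexp (c * Y m \<omega>) - iexp (c * Z \<omega>))) \<le> \<bar>c\<bar> * \<epsilon> + 2 * prob (A m)" for m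
  proof -
    have "(LINT \<omega>|M. cmod (iexp (c * Y m \<omega>) - iexp (c * Z \<omega>)))
        \<le> (LINT \<omega>|M. \<bar>c\<bar> * \<epsilon> + 2 * indicator (A m) \<omega>)"
    proof (rule integral_mono[OF int])
      fix \<omega> assume "\<omega> \<in> space M"
      show "cmod (iexp (c * Y m \<omega>) - iexp (c * Z \<omega>)) \<le> \<bar>c\<bar> * \<epsilon> + 2 * indicator (A m) \<omega>"
      proof (cases "\<omega> \<in> A m")
        case True
        have "0 \<le> \<bar>c\<bar> * \<epsilon>"
          using \<epsilon> by simp
        then show ?thesis
          using True bound(2)[of "c * Y m \<omega>" "c * Z \<omega>"] by simp
      next
        case False
        then have "\<bar>c\<bar> * \<bar>Y m \<omega> - Z \<omega>\<bar> \<le> \<bar>c\<bar> * \<epsilon>"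
          using \<open>\<omega> \<in> space M\<close> by (intro mult_left_mono) (auto simp: A_def)
        then show ?thesis
          using False bound(1)[of "c * Y m \<omega>" "c * Z \<omega>"]
          by (simp add: abs_mult[symmetric] right_diff_distrib del: of_real_mult)
      qed
    qed (auto intro!: integrable_add integrable_real_indicator simp: emeasure_eq_measure)
    also have "\<dots> = \<bar>c\<bar> * \<epsilon> + 2 * prob (A m)"
      by (subst Bochner_Integration.integral_add) (auto simp: prob_space emeasure_eq_measure)
    finally show ?thesis .
  qed
  have "(\<lambda>m. prob (A m)) \<longlonglongrightarrow> 0"
    unfolding A_def by (rule conv[OF \<epsilon>(1)])
  then have "\<forall>\<^sub>F m in sequentially. prob (A m) < e / 4"
    by (rule order_tendstoD) (use e in simp)
  then show "\<forall>\<^sub>F m in sequentially.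
      dist (LINT \<omega>|M. cmod (iexp (c * Y m \<omega>) - iexp (c * Z \<omega>))) 0 < e"
  proof eventually_elim
    case (elim m)
    then show ?case
      using le[of m] \<epsilon>(2) by simp
  qed
qed

text \<open>The joint exponential is a product of factors of modulus 1, and two such products differ
  by at most the sum of the factorwise differences. So convergence coordinate by coordinate
  suffices.\<close>

lemma tendsto_in_prob_joint_char:
  assumes "prob_space M" and [measurable]: "\<And>m j. j < k \<Longrightarrow> X (u m j) \<in> borel_measurable M"
      "\<And>j. j < k \<Longrightarrow> X (v j) \<in> borel_measurable M"
    and conv: "\<And>j \<epsilon>. j < k \<Longrightarrow> \<epsilon> > 0 \<Longrightarrow>
      (\<lambda>m. measure M {\<omega>\<in>space M. \<bar>X (u m j) \<omega> - X (v j) \<omega>\<bar> > \<epsilon>}) \<longlonglongrightarrow> 0"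
  shows "(\<lambda>m. joint_char M X k (u m) \<theta>) \<longlonglongrightarrow> joint_char M X k v \<theta>"
proof -
  interpret prob_space M by fact
  define d where "d m j \<omega> = cmod (iexp (\<theta> j * X (u m j) \<omega>) - iexp (\<theta> j * X (v j) \<omega>))" for m j \<omega>
  have d_int: "integrable M (d m j)" if [simp]: "j < k" for m j
    unfolding d_def by (intro integrable_norm Bochner_Integration.integrable_diff integrable_iexp) auto
  have int: "integrable M (\<lambda>\<omega>. iexp (\<Sum>j<k. \<theta> j * X (w j) \<omega>))"
    if [measurable]: "\<And>j. j < k \<Longrightarrow> X (w j) \<in> borel_measurable M" for w
    by (rule integrable_iexp) auto
  have bound: "norm (joint_char M X k (u m) \<theta> - joint_char M X k v \<theta>)
      \<le> (\<Sum>j<k. (LINT \<omega>|M. d m j \<omega>))" for m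
  proof -
    have "norm (joint_char M X k (u m) \<theta> - joint_char M X k v \<theta>) \<le>
        (LINT \<omega>|M. norm (iexp (\<Sum>j<k. \<theta> j * X (u m j) \<omega>) - iexp (\<Sum>j<k. \<theta> j * X (v j) \<omega>)))"
      using integral_norm_bound[of M
          "\<lambda>\<omega>. iexp (\<Sum>j<k. \<theta> j * X (u m j) \<omega>) - iexp (\<Sum>j<k. \<theta> j * X (v j) \<omega>)"]
      by (simp add: int del: of_real_sum of_real_mult)
    also have "\<dots> \<le> (LINT \<omega>|M. (\<Sum>j<k. d m j \<omega>))"
    proof (rule integral_mono)
      show "integrable M (\<lambda>\<omega>. norm (iexp (\<Sum>j<k. \<theta> j * X (u m j) \<omega>) - iexp (\<Sum>j<k. \<theta> j * X (v j) \<omega>)))"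
        by (intro integrable_norm Bochner_Integration.integrable_diff int) auto
      show "integrable M (\<lambda>\<omega>. \<Sum>j<k. d m j \<omega>)"
        by (intro Bochner_Integration.integrable_sum d_int) auto
      fix \<omega>
      have "norm ((\<Prod>j<k. iexp (\<theta> j * X (u m j) \<omega>)) - (\<Prod>j<k. iexp (\<theta> j * X (v j) \<omega>))) \<le> (\<Sum>j<k. d m j \<omega>)"
        unfolding d_def by (rule norm_prod_diff) (simp_all del: of_real_mult)
      then show "norm (iexp (\<Sum>j<k. \<theta> j * X (u m j) \<omega>) - iexp (\<Sum>j<k. \<theta> j * X (v j) \<omega>)) \<le> (\<Sum>j<k. d m j \<omega>)"
        by (simp add: exp_sum sum_distrib_left)
    qed
    also have "\<dots> = (\<Sum>j<k. (LINT \<omega>|M. d m j \<omega>))"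
      by (rule Bochner_Integration.integral_sum) (simp add: d_int)
    finally show ?thesis .
  qed
  have "(\<lambda>m. \<Sum>j<k. (LINT \<omega>|M. d m j \<omega>)) \<longlonglongrightarrow> 0"
    unfolding d_def
    by (intro tendsto_null_sum tendsto_in_prob_iexp conv) auto
  from Lim_null_comparison[OF always_eventually[OF allI[OF bound]] this]
  have "(\<lambda>m. joint_char M X k (u m) \<theta> - joint_char M X k v \<theta>) \<longlonglongrightarrow> 0" .
  then show ?thesis
    by (rule Lim_null[THEN iffD2])
qed

section \<open>Both directions of (a) and (b) from the scaling lemmas\<close>

theorem lemma3p2:
  fixes M :: "'a measure" and \<delta> :: real
  assumes "\<delta> \<noteq> 0"
  shows
    "(\<forall>V. stochastically_continuous M UNIV V \<and> translatively_stable \<delta> M V \<and>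
          tends_in_prob M V (\<lambda>_. 0) at_bot \<longrightarrow>
          time_stable \<delta> M (\<lambda>t. if t = 0 then (\<lambda>_. 0) else V (ln t))) \<and>
     (\<forall>Z. time_stable \<delta> M Z \<longrightarrow> translatively_stable \<delta> M (\<lambda>t. Z (exp t))) \<and>
     (\<forall>V. translatively_stable \<delta> M V \<longrightarrow>
          IDT M (\<lambda>t. if t = 0 then (\<lambda>_. 0) else V (1 / \<delta> * ln t))) \<and>
     (\<forall>D. IDT M D \<and> fdd_weakly_right_continuous M {0..} D \<longrightarrow>
          translatively_stable \<delta> M (\<lambda>t. D (exp (\<delta> * t))))"
proof (intro conjI allI impI; (elim conjE)?)
  have time_stable_iff: "time_stable \<delta> M Z \<longleftrightarrow>
      time_scaling (1 / \<delta>) M Z \<and> stochastically_continuous M {0..} Z" for Z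
    unfolding time_stable_def time_scaling_def by blast
  have IDT_iff: "IDT M D \<longleftrightarrow> time_scaling 1 M D" for D
    unfolding IDT_def time_scaling_def by simp
  show "time_stable \<delta> M (\<lambda>t. if t = 0 then (\<lambda>_. 0) else V (ln t))"
    if "stochastically_continuous M UNIV V" "translatively_stable \<delta> M V"
      "tends_in_prob M V (\<lambda>_. 0) at_bot" for V
    using time_scaling_ln[OF that(2), of 1 "1 / \<delta>"] stochastically_continuous_ln[OF that(1,3)] assms
    by (simp add: time_stable_iff cong: if_cong)
  show "IDT M (\<lambda>t. if t = 0 then (\<lambda>_. 0) else V (1 / \<delta> * ln t))"
    if "translatively_stable \<delta> M V" for V
    using time_scaling_ln[OF that, of "1 / \<delta>" 1] assms by (simp add: IDT_iff)
  show "translatively_stable \<delta> M (\<lambda>t. Z (exp t))" if Z: "time_stable \<delta> M Z" for Z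
  proof -
    have sc: "time_scaling (1 / \<delta>) M Z" and cont: "stochastically_continuous M {0..} Z"
      using Z by (auto simp: time_stable_iff)
    have "translatively_stable \<delta> M (\<lambda>t. Z (exp (\<delta> * (1 / \<delta>) * t)))"
    proof (rule translatively_stable_exp[OF sc tendsto_in_prob_joint_char])
      have rp: "real_process M {0..} Z"
        using sc by (simp add: time_scaling_def infinitely_divisible_def)
      then show "prob_space M"
        by (simp add: real_process_def)
      fix q :: "nat \<Rightarrow> real" and c \<epsilon> :: real and t :: "nat \<Rightarrow> real" and j m :: nat
      assume t: "\<And>j. t j > 0"
      then have nonneg: "x powr (1 / \<delta>) * t j \<ge> 0" for x j
        by (simp add: less_imp_le)
      then show "Z (q m powr (1 / \<delta>) * t j) \<in> borel_measurable M"
          "Z (c powr (1 / \<delta>) * t j) \<in> borel_measurable M"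
        using rp by (auto simp: real_process_def)
      assume q: "c > 0" "\<And>i. q i > c" "q \<longlonglongrightarrow> c" and \<epsilon>: "\<epsilon> > 0"
      \<comment> \<open>Stochastic continuity is a limit along a punctured filter, so the
        approximating times must differ from the limit time; raising to the power \<delta> inverts
        the exponent 1 / \<delta>.\<close>
      have ne: "q i powr (1 / \<delta>) \<noteq> c powr (1 / \<delta>)" for i
      proof
        assume "q i powr (1 / \<delta>) = c powr (1 / \<delta>)"
        then have "(q i powr (1 / \<delta>)) powr \<delta> = (c powr (1 / \<delta>)) powr \<delta>"
          by simp
        then show False
          using q(1) q(2)[of i] assms by (simp add: powr_powr)
      qed
      have "filterlim (\<lambda>i. q i powr (1 / \<delta>) * t j) (at (c powr (1 / \<delta>) * t j) within {0..}) sequentially"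
        unfolding filterlim_at using ne nonneg t[of j] q(1)
        by (auto intro!: tendsto_intros q(3))
      moreover have "((\<lambda>s. measure M {\<omega>\<in>space M. \<bar>Z s \<omega> - Z (c powr (1 / \<delta>) * t j) \<omega>\<bar> > \<epsilon>}) \<longlongrightarrow> 0)
          (at (c powr (1 / \<delta>) * t j) within {0..})"
        using cont nonneg \<epsilon> by (auto simp: stochastically_continuous_def tends_in_prob_def)
      ultimately show "(\<lambda>m. measure M {\<omega>\<in>space M.
          \<bar>Z (q m powr (1 / \<delta>) * t j) \<omega> - Z (c powr (1 / \<delta>) * t j) \<omega>\<bar> > \<epsilon>}) \<longlonglongrightarrow> 0"
        using filterlim_compose by blast
    qed
    then show ?thesis
      using assms by simp
  qed
  show "translatively_stable \<delta> M (\<lambda>t. D (exp (\<delta> * t)))"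
    if D: "IDT M D" and right: "fdd_weakly_right_continuous M {0..} D" for D
  proof -
    have sc: "time_scaling 1 M D"
      using D by (simp add: IDT_iff)
    have rp: "real_process M {0..} D"
      using sc by (simp add: time_scaling_def infinitely_divisible_def)
    have "translatively_stable \<delta> M (\<lambda>t. D (exp (\<delta> * 1 * t)))"
    proof (rule translatively_stable_exp[OF sc vec_weakly_converges_joint_char[OF _ rp]])
      fix k and q :: "nat \<Rightarrow> real" and c :: real and t :: "nat \<Rightarrow> real"
      assume t: "\<And>j. t j > 0" and q: "c > 0" "\<And>i. q i > c" "q \<longlonglongrightarrow> c"
      then have nonneg: "x powr 1 * t j \<ge> 0" for x j
        by (simp add: less_imp_le)
      then show "(\<lambda>j. q m powr 1 * t j) \<in> {..<k} \<rightarrow> {0..}" and v: "(\<lambda>j. c powr 1 * t j) \<in> {..<k} \<rightarrow> {0..}" for m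
        by auto
      \<comment> \<open>Here the exponent is 1, so q_i > c and t_j > 0 put the approximating times
        strictly to the right of the limit time.\<close>
      have "filterlim (\<lambda>m. q m powr 1 * t j) (at_right (c powr 1 * t j)) sequentially" for j
      proof -
        have "q i > 0" "q i \<noteq> c" for i
          using q(1) q(2)[of i] by simp_all
        then show ?thesis
          unfolding filterlim_at using t[of j] q
          by (auto simp: less_imp_le intro!: tendsto_intros)
      qed
      then show "vec_weakly_converges k (\<lambda>m. fdd M D k (\<lambda>j. q m powr 1 * t j))
          (fdd M D k (\<lambda>j. c powr 1 * t j))"
        using right v nonneg unfolding fdd_weakly_right_continuous_def by auto
    qed
    then show ?thesis
      by simp
  qed
qed

end
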